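(* Let $\mathbb{K}\in\{\mathbb{R},\mathbb{C}\}$, $G=\mathrm{GL}_6(\mathbb{K})$. For $x\in G$ define the rank matrix $\mathrm{R}(x)=\begin{bmatrix}\mathrm{rank}_{4\times4}(x)&\mathrm{rank}_{4\times2}(x)\\ \mathrm{rank}_{2\times4}(x)&\mathrm{rank}_{2\times2}(x)\end{bmatrix}$, where $\mathrm{rank}_{i\times j}(x)$ is the rank of the lower right $i\times j$ block of $x$, and for a $2\times2$ integer matrix $R$ put $G_R=\{x\in G:\mathrm{R}(x)=R\}$ (these nonempty sets are exactly the $P$-$P^\tau$ double cosets in $G$, where $P$ is the parabolic subgroup of block upper triangular matrices with three $2\times2$ diagonal blocks). Let $x_{\mathrm{left}}=\begin{bmatrix}0&I_2&0\\0&0&I_2\\0&0&0\end{bmatrix}$, $x_{\mathrm{right}}=x_{\mathrm{left}}^\tau$, let $X_{\mathrm{left}}$ be the left invariant vector field on $G$ whose value at $x$ is $xx_{\mathrm{left}}$, and $X_{\mathrm{right}}$ the right invariant vector field whose value at $x$ is $x_{\mathrm{right}}x$. Let $R$ be such that $G_R\neq\emptyset$ and $R$ is not one of $\begin{bmatrix}4&2\\2&2\end{bmatrix},\begin{bmatrix}4&2\\2&1\end{bmatrix},\begin{bmatrix}3&2\\2&2\end{bmatrix},\begin{bmatrix}3&2\\2&1\end{bmatrix}$. Then either $X_{\mathrm{left}}$ or $X_{\mathrm{right}}$ is transversal to $G_R$.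
   Context: A vector field $X$ on $M$ is transversal to a submanifold $Z$ if $X(z)\notin \mathrm{T}_z(Z)$ for all $z\in Z$. $\tau$ denotes matrix transpose. *)

theory Defs
  imports "HOL-Analysis.Analysis" "HOL-Library.Numeral_Type"
begin

definition idx6 :: "6 \<Rightarrow> nat" where
  "idx6 r = nat (Rep_bit0 r)"

text \<open>The lower right i x j block of x, embedded in a 6x6 matrix (other entries 0);
  its rank equals the rank of the block itself.\<close>
definition lr_block :: "nat \<Rightarrow> nat \<Rightarrow> 'a::field^6^6 \<Rightarrow> 'a^6^6" where
  "lr_block i j x = (\<chi> r c. if 6 - i \<le> idx6 r \<and> 6 - j \<le> idx6 c then x $ r $ c else 0)"

definition rank_blk :: "nat \<Rightarrow> nat \<Rightarrow> 'a::field^6^6 \<Rightarrow> nat" where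
  "rank_blk i j x = rank (lr_block i j x)"

text \<open>The rank matrix R(x), encoded as the tuple (R11, R12, R21, R22).\<close>
definition rank_matrix :: "'a::field^6^6 \<Rightarrow> int \<times> int \<times> int \<times> int" where
  "rank_matrix x = (int (rank_blk 4 4 x), int (rank_blk 4 2 x), int (rank_blk 2 4 x), int (rank_blk 2 2 x))"

definition G_R :: "int \<times> int \<times> int \<times> int \<Rightarrow> ('a::field^6^6) set" where
  "G_R R = {x. invertible x \<and> rank_matrix x = R}"

definition x_left :: "'a::field^6^6" where
  "x_left = (\<chi> r c. if idx6 c = idx6 r + 2 then 1 else 0)"

definition x_right :: "'a::field^6^6" where
  "x_right = transpose x_left"

definition X_left :: "'a::field^6^6 \<Rightarrow> 'a^6^6" where
  "X_left x = x ** x_left"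

definition X_right :: "'a::field^6^6 \<Rightarrow> 'a^6^6" where
  "X_right x = x_right ** x"

text \<open>Tangent space of a subset S (an embedded submanifold) of a real normed vector space at z:
  velocities at 0 of curves in S through z that are differentiable at 0.
  (For complex matrices this is the real tangent space, which as a set equals the complex one.)\<close>
definition tangent_space :: "'v::real_normed_vector set \<Rightarrow> 'v \<Rightarrow> 'v set" where
  "tangent_space S z = {v. \<exists>\<gamma>::real \<Rightarrow> 'v. \<gamma> 0 = z \<and> (\<forall>t. \<gamma> t \<in> S) \<and>
                              (\<gamma> has_vector_derivative v) (at 0)}"

definition transversal :: "('v::real_normed_vector \<Rightarrow> 'v) \<Rightarrow> 'v set \<Rightarrow> bool" where
  "transversal X Z \<longleftrightarrow> (\<forall>z\<in>Z. X z \<notin> tangent_space Z z)"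

definition exceptional_R :: "(int \<times> int \<times> int \<times> int) set" where
  "exceptional_R = {(4,2,2,2), (4,2,2,1), (3,2,2,2), (3,2,2,1)}"

end

theory Submission
  imports Defs
begin

text \<open>
  Along a curve in \<open>G_R\<close> the ranks of the lower right blocks are constant, so every minor of a
  block that vanishes identically along the curve has vanishing derivative. The velocity
  \<open>X_right z = x_right z\<close> is \<open>z\<close> with its rows moved two places down, and \<open>X_left z = z x_left\<close>
  is \<open>z\<close> with its columns moved two places right, so the differentiated minors tie the first
  two rows (columns) of \<open>z\<close> to the block. If \<open>R12 \<le> 1\<close> or \<open>R22 = 0\<close> this forces either the
  lower right 4\<times>2 block to vanish or a linear relation among the columns of the invertible
  \<open>z\<close>, so \<open>X_right\<close> is transversal; transposition swaps \<open>X_left\<close> with \<open>X_right\<close> and \<open>R12\<close> with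
  \<open>R21\<close>. In the remaining non-exceptional cases \<open>R12 = 2\<close> and \<open>R11 \<le> 2\<close>: a nonzero 2\<times>2 minor
  of the 4\<times>2 block together with the vanishing 3\<times>3 minors of the 4\<times>4 block and their
  derivatives along \<open>X_left\<close> yields a linear relation among the rows of \<open>z\<close>.
\<close>

section \<open>Rank and minors over a field\<close>

definition minor2 :: "'a::field^'n^'m \<Rightarrow> 'm \<Rightarrow> 'm \<Rightarrow> 'n \<Rightarrow> 'n \<Rightarrow> 'a" where
  "minor2 A p p' q q' = A$p$q * A$p'$q' - A$p$q' * A$p'$q"

definition det3 :: "'a::comm_ring \<Rightarrow> 'a \<Rightarrow> 'a \<Rightarrow> 'a \<Rightarrow> 'a \<Rightarrow> 'a \<Rightarrow> 'a \<Rightarrow> 'a \<Rightarrow> 'a \<Rightarrow> 'a" where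
  "det3 a11 a12 a13 a21 a22 a23 a31 a32 a33 =
     a11 * (a22 * a33 - a23 * a32) - a12 * (a21 * a33 - a23 * a31) + a13 * (a21 * a32 - a22 * a31)"

definition minor3 :: "'a::field^'n^'m \<Rightarrow> 'm \<Rightarrow> 'm \<Rightarrow> 'm \<Rightarrow> 'n \<Rightarrow> 'n \<Rightarrow> 'n \<Rightarrow> 'a" where
  "minor3 A p1 p2 p3 q1 q2 q3 = det3 (A$p1$q1) (A$p1$q2) (A$p1$q3) (A$p2$q1) (A$p2$q2) (A$p2$q3)
      (A$p3$q1) (A$p3$q2) (A$p3$q3)"

lemma minor2_transpose: "minor2 (transpose A) p p' q q' = minor2 A q q' p p'"
  by (simp add: minor2_def transpose_def)

lemma rank_le_card_span: "rows A \<subseteq> vec.span W \<Longrightarrow> finite W \<Longrightarrow> rank A \<le> card W"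
  unfolding row_rank_def_gen by (rule vec.dim_le_card)

lemma rank_ge_card_independent: "B \<subseteq> rows A \<Longrightarrow> vec.independent B \<Longrightarrow> card B \<le> rank A"
  unfolding row_rank_def_gen by (rule vec.independent_card_le_dim)

lemma row_in_rows: "A $ p \<in> rows A"
  unfolding rows_def row_def by (auto simp: vec_lambda_eta)

lemma rank_le_card_nonzero_rows:
  fixes A :: "'a::field^'n^'m"
  assumes "\<And>r. r \<notin> S \<Longrightarrow> A $ r = 0"
  shows "rank A \<le> card S"
proof -
  have "rows A \<subseteq> vec.span ((\<lambda>r. A $ r) ` S)"
  proof
    fix y assume "y \<in> rows A"
    then obtain r where "y = A $ r" unfolding rows_def row_def by (auto simp: vec_lambda_eta)
    then show "y \<in> vec.span ((\<lambda>r. A $ r) ` S)"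
      using assms[of r] by (cases "r \<in> S") (auto intro: vec.span_base simp: vec.span_zero)
  qed
  then have "rank A \<le> card ((\<lambda>r. A $ r) ` S)" by (rule rank_le_card_span) simp
  also have "\<dots> \<le> card S" by (rule card_image_le) simp
  finally show ?thesis .
qed

lemma rank_le_card_nonzero_columns:
  fixes A :: "'a::field^'n^'m"
  assumes "\<And>r c. c \<notin> T \<Longrightarrow> A $ r $ c = 0"
  shows "rank A \<le> card T"
proof -
  have "rows A \<subseteq> vec.span ((\<lambda>c. axis c 1) ` T)"
  proof
    fix y assume "y \<in> rows A"
    then obtain r where y: "y = A $ r" unfolding rows_def row_def by (auto simp: vec_lambda_eta)
    have "y = (\<Sum>c\<in>T. y $ c *s axis c 1)"
      using assms by (auto simp: vec_eq_iff axis_def y if_distrib cong: if_cong)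
    also have "\<dots> \<in> vec.span ((\<lambda>c. axis c 1) ` T)"
      by (intro vec.span_sum vec.span_scale vec.span_base) auto
    finally show "y \<in> vec.span ((\<lambda>c. axis c 1) ` T)" .
  qed
  then have "rank A \<le> card ((\<lambda>c. axis c (1::'a)) ` T)" by (rule rank_le_card_span) simp
  also have "\<dots> \<le> card T" by (rule card_image_le) simp
  finally show ?thesis .
qed

lemma rank_eq_0_gen: "rank A = 0 \<longleftrightarrow> A = 0" for A :: "'a::field^'n^'m"
proof
  assume "A = 0"
  then show "rank A = 0" using rank_le_card_nonzero_rows[of "{}" A] by simp
next
  assume rk: "rank A = 0"
  show "A = 0"
  proof (rule ccontr)
    assume "A \<noteq> 0"
    then obtain p where "A $ p \<noteq> 0" by (auto simp: vec_eq_iff)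
    then have "vec.independent {A $ p}" by (simp add: vec.independent_insert vec.span_empty)
    then have "card {A $ p} \<le> rank A" using row_in_rows by (intro rank_ge_card_independent) auto
    with rk show False by simp
  qed
qed

lemma rank_ge_2_if_minor2_nonzero:
  fixes A :: "'a::field^'n^'m"
  assumes "minor2 A p p' q q' \<noteq> 0" shows "2 \<le> rank A"
proof -
  have r2: "A $ p' \<noteq> 0" using assms by (auto simp: minor2_def)
  have ns: "A $ p \<notin> vec.span {A $ p'}"
  proof
    assume "A $ p \<in> vec.span {A $ p'}"
    then obtain k where "A $ p = k *s A $ p'" by (auto simp: vec.span_singleton)
    then have "minor2 A p p' q q' = 0" by (simp add: minor2_def)
    with assms show False by simp
  qed
  have neq: "A $ p \<noteq> A $ p'" using ns vec.span_base[of "A $ p'" "{A $ p'}"] by auto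
  have "vec.independent {A $ p, A $ p'}"
    using r2 ns neq by (simp add: vec.independent_insert vec.span_empty)
  then have "card {A $ p, A $ p'} \<le> rank A" using row_in_rows by (intro rank_ge_card_independent) auto
  then show ?thesis using neq by simp
qed

lemma rank_ge_3_if_minor3_nonzero:
  fixes A :: "'a::field^'n^'m"
  assumes "minor3 A p1 p2 p3 q1 q2 q3 \<noteq> 0" shows "3 \<le> rank A"
proof -
  have r3: "A $ p3 \<noteq> 0"
  proof
    assume "A $ p3 = 0"
    then have "minor3 A p1 p2 p3 q1 q2 q3 = 0" by (simp add: minor3_def det3_def)
    with assms show False by simp
  qed
  have ns2: "A $ p2 \<notin> vec.span {A $ p3}"
  proof
    assume "A $ p2 \<in> vec.span {A $ p3}"
    then obtain k where k: "A $ p2 = k *s A $ p3" by (auto simp: vec.span_singleton)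
    have "minor3 A p1 p2 p3 q1 q2 q3 = 0" unfolding minor3_def k by (simp add: det3_def algebra_simps)
    with assms show False by simp
  qed
  have ns1: "A $ p1 \<notin> vec.span {A $ p2, A $ p3}"
  proof
    assume "A $ p1 \<in> vec.span {A $ p2, A $ p3}"
    then obtain k where "A $ p1 - k *s A $ p2 \<in> vec.span {A $ p3}" by (auto simp: vec.span_breakdown_eq)
    then obtain c where "A $ p1 - k *s A $ p2 = c *s A $ p3" by (auto simp: vec.span_singleton)
    then have e: "A $ p1 = k *s A $ p2 + c *s A $ p3" by (metis diff_eq_eq add.commute)
    have "minor3 A p1 p2 p3 q1 q2 q3 = 0" unfolding minor3_def e by (simp add: det3_def algebra_simps)
    with assms show False by simp
  qed
  have n23: "A $ p2 \<noteq> A $ p3" using ns2 vec.span_base[of "A $ p3" "{A $ p3}"] by auto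
  have n12: "A $ p1 \<noteq> A $ p2" "A $ p1 \<noteq> A $ p3"
    using ns1 vec.span_base[of "A $ p2" "{A $ p2, A $ p3}"] vec.span_base[of "A $ p3" "{A $ p2, A $ p3}"]
    by auto
  have "vec.independent {A $ p1, A $ p2, A $ p3}"
    using r3 ns1 ns2 n12 n23 by (simp add: vec.independent_insert vec.span_empty)
  then have "card {A $ p1, A $ p2, A $ p3} \<le> rank A" using row_in_rows by (intro rank_ge_card_independent) auto
  then show ?thesis using n12 n23 by simp
qed

lemma rank_le_1_if_minors2_vanish:
  fixes A :: "'a::field^'n^'m"
  assumes "\<And>p p' q q'. minor2 A p p' q q' = 0" shows "rank A \<le> 1"
proof (cases "A = 0")
  case True
  then have "rank A = 0" by (simp only: rank_eq_0_gen)
  then show ?thesis by simp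
next
  case False
  then obtain p q where pq: "A $ p $ q \<noteq> 0" by (metis vec_eq_iff zero_index)
  have "rows A \<subseteq> vec.span {A $ p}"
  proof
    fix x assume "x \<in> rows A"
    then obtain r where x: "x = A $ r" unfolding rows_def row_def by (auto simp: vec_lambda_eta)
    have "A $ r = (A$r$q / A$p$q) *s A $ p"
    proof (subst vec_eq_iff, intro allI)
      fix c
      have "minor2 A p r q c = 0" by (rule assms)
      then show "A $ r $ c = ((A$r$q / A$p$q) *s A $ p) $ c" using pq
        by (simp add: minor2_def field_simps)
    qed
    then show "x \<in> vec.span {A $ p}" unfolding x by (auto simp: vec.span_singleton)
  qed
  from rank_le_card_span[OF this] show ?thesis by simp
qed

lemma rank_transpose_le_1:
  fixes A :: "'a::field^'n^'m"
  assumes "rank A \<le> 1" shows "rank (transpose A) \<le> 1"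
proof (rule rank_le_1_if_minors2_vanish)
  show "minor2 (transpose A) p p' q q' = 0" for p p' q q'
    using rank_ge_2_if_minor2_nonzero[of A q q' p p'] assms by (auto simp: minor2_transpose)
qed

lemma invertible_transpose_gen:
  fixes A :: "'a::comm_semiring_1^'n^'n"
  assumes "invertible A" shows "invertible (transpose A)"
  using assms unfolding invertible_def by (metis matrix_transpose_mul transpose_mat)

lemma invertible_kernel_trivial:
  fixes A :: "'a::field^'n^'n"
  shows "invertible A \<Longrightarrow> A *v x = 0 \<Longrightarrow> x = 0"
  by (metis invertible_left_inverse matrix_left_invertible_ker)

lemma invertible_cokernel_trivial:
  fixes A :: "'a::field^'n^'n"
  shows "invertible A \<Longrightarrow> x v* A = 0 \<Longrightarrow> x = 0"
  by (metis invertible_kernel_trivial invertible_transpose_gen transpose_matrix_vector)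

lemma transpose_eq_0_iff: "transpose A = 0 \<longleftrightarrow> A = (0::'a::zero^'n^'m)"
  by (auto simp: vec_eq_iff transpose_def)

lemma matrix_vector_mult_axis_nth: "(A *v axis q c) $ r = A $ r $ q * c"
  by (simp add: matrix_vector_mult_def axis_def if_distrib cong: if_cong)

lemma vector_matrix_mult_axis_nth: "(axis p c v* A) $ q = A $ p $ q * (c::'a::comm_semiring_1)"
  using matrix_vector_mult_axis_nth[of "transpose A" p c q]
  by (simp only: transpose_matrix_vector) (simp add: transpose_def)

lemma not_invertible_if_column_zero:
  fixes A :: "'a::field^'n^'n"
  assumes "\<And>r. A $ r $ q = 0" shows "\<not> invertible A"
proof
  assume "invertible A"
  moreover have "A *v axis q 1 = 0" using assms by (simp add: vec_eq_iff matrix_vector_mult_axis_nth)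
  ultimately show False using invertible_kernel_trivial axis_eq_0_iff one_neq_zero by metis
qed

lemma not_invertible_if_minors2_vanish:
  fixes A :: "'a::field^'n^'n"
  assumes "q \<noteq> q'" "A$s$q \<noteq> 0 \<or> A$s$q' \<noteq> 0" "\<And>r. minor2 A r s q q' = 0"
  shows "\<not> invertible A"
proof
  assume inv: "invertible A"
  let ?u = "axis q (A$s$q') + axis q' (- A$s$q)"
  have "A *v ?u = 0"
    using assms(3) by (simp add: vec_eq_iff matrix_vector_right_distrib matrix_vector_mult_axis_nth minor2_def)
  from invertible_kernel_trivial[OF inv this] have "?u $ q = 0" "?u $ q' = 0" by simp_all
  with assms(1,2) show False by (simp add: axis_def)
qed

lemma not_invertible_if_minors3_vanish:
  fixes A :: "'a::field^'n^'n"
  assumes "a \<noteq> i" "a \<noteq> k" "minor2 A i k q q' \<noteq> 0" "\<And>c. minor3 A a i k c q q' = 0"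
  shows "\<not> invertible A"
proof
  assume inv: "invertible A"
  let ?w = "axis a (minor2 A i k q q') + axis i (- minor2 A a k q q') + axis k (minor2 A a i q q')"
  have "?w v* A = 0"
    using assms(4) by (simp add: vec_eq_iff vector_matrix_left_distrib vector_matrix_mult_axis_nth
        minor2_def minor3_def det3_def algebra_simps)
  from invertible_cokernel_trivial[OF inv this] have "?w $ a = 0" by simp
  with assms(1-3) show False by (simp add: axis_def)
qed

section \<open>Lower right blocks of 6\<times>6 matrices\<close>

lemma idx6_simps [simp]: "idx6 0 = 0" "idx6 1 = 1" "idx6 2 = 2" "idx6 3 = 3" "idx6 4 = 4" "idx6 5 = 5"
  by (simp_all add: idx6_def bit0.Rep_numeral bit0.Rep_0 bit0.Rep_1)

lemma exhaust_6: "r = 0 \<or> r = 1 \<or> r = 2 \<or> r = 3 \<or> r = 4 \<or> r = (5::6)"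
proof (cases r)
  case (of_int z)
  then have "z = 0 \<or> z = 1 \<or> z = 2 \<or> z = 3 \<or> z = 4 \<or> z = 5" by auto
  then show ?thesis using of_int by auto
qed

lemma sum_6: "(\<Sum>r\<in>UNIV. f r) = f (0::6) + (f 1 + (f 2 + (f 3 + (f 4 + f 5))))"
proof -
  have "(UNIV::6 set) = {0,1,2,3,4,5}" using exhaust_6 by blast
  then show ?thesis unfolding \<open>UNIV = _\<close> by simp
qed

lemma idx6_less_6: "idx6 r < 6"
  using exhaust_6[of r] by auto

lemma card_idx6_ge: "card {r::6. k \<le> idx6 r} \<le> 6 - k"
proof -
  have "inj idx6"
  proof (rule injI)
    fix r s :: 6 assume "idx6 r = idx6 s"
    then show "r = s" using exhaust_6[of r] exhaust_6[of s] by auto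
  qed
  then have "card {r::6. k \<le> idx6 r} = card (idx6 ` {r. k \<le> idx6 r})"
    by (simp add: card_image inj_on_subset)
  also have "\<dots> \<le> card {k..<6}"
  proof (rule card_mono)
    show "idx6 ` {r. k \<le> idx6 r} \<subseteq> {k..<6}" using idx6_less_6 by auto
  qed simp
  finally show ?thesis by simp
qed

lemma lr_block_nth [simp]:
  "lr_block i j x $ r $ c = (if 6 - i \<le> idx6 r \<and> 6 - j \<le> idx6 c then x $ r $ c else 0)"
  by (simp add: lr_block_def)

lemma lr_block_transpose: "lr_block i j (transpose x) = transpose (lr_block j i x)"
  by (simp add: vec_eq_iff transpose_def)

lemma lr_block_eq_0_entry:
  assumes "lr_block i j x = 0" "6 - i \<le> idx6 r" "6 - j \<le> idx6 c" shows "x $ r $ c = 0"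
  using assms by (metis lr_block_nth zero_index)

lemma lr_block_neq_0_entry:
  assumes "lr_block i j x \<noteq> 0"
  obtains r c where "6 - i \<le> idx6 r" "6 - j \<le> idx6 c" "x $ r $ c \<noteq> 0"
  using assms by (metis (no_types, lifting) lr_block_nth vec_eq_iff zero_index)

lemma minor2_lr_block_vanish:
  fixes x :: "'a::field^6^6"
  assumes "rank_blk i j x \<le> 1" "6 - i \<le> idx6 p" "6 - i \<le> idx6 p'" "6 - j \<le> idx6 q" "6 - j \<le> idx6 q'"
  shows "minor2 x p p' q q' = 0"
proof (rule ccontr)
  assume "minor2 x p p' q q' \<noteq> 0"
  then have "minor2 (lr_block i j x) p p' q q' \<noteq> 0" using assms by (simp add: minor2_def)
  from rank_ge_2_if_minor2_nonzero[OF this] assms(1) show False by (simp add: rank_blk_def)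
qed

lemma minor3_lr_block_vanish:
  fixes x :: "'a::field^6^6"
  assumes "rank_blk i j x \<le> 2" "6 - i \<le> idx6 p1" "6 - i \<le> idx6 p2" "6 - i \<le> idx6 p3"
    "6 - j \<le> idx6 q1" "6 - j \<le> idx6 q2" "6 - j \<le> idx6 q3"
  shows "minor3 x p1 p2 p3 q1 q2 q3 = 0"
proof (rule ccontr)
  assume "minor3 x p1 p2 p3 q1 q2 q3 \<noteq> 0"
  then have "minor3 (lr_block i j x) p1 p2 p3 q1 q2 q3 \<noteq> 0" using assms by (simp add: minor3_def)
  from rank_ge_3_if_minor3_nonzero[OF this] assms(1) show False by (simp add: rank_blk_def)
qed

lemma minor2_lr_block_nonzero:
  fixes x :: "'a::field^6^6"
  assumes "2 \<le> rank_blk i j x"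
  obtains p p' q q' where "6 - i \<le> idx6 p" "6 - i \<le> idx6 p'" "6 - j \<le> idx6 q" "6 - j \<le> idx6 q'"
    "minor2 x p p' q q' \<noteq> 0"
proof -
  obtain p p' q q' where nz: "minor2 (lr_block i j x) p p' q q' \<noteq> 0"
    using rank_le_1_if_minors2_vanish[of "lr_block i j x"] assms by (fastforce simp: rank_blk_def)
  then have "6 - i \<le> idx6 p" "6 - i \<le> idx6 p'" "6 - j \<le> idx6 q" "6 - j \<le> idx6 q'"
    by (rule contrapos_np, simp add: minor2_def)+
  with nz show thesis using that by (simp add: minor2_def)
qed

lemma rank_blk_le_rows: "rank_blk i j x \<le> i"
proof -
  have "rank_blk i j x \<le> card {r::6. 6 - i \<le> idx6 r}"
    unfolding rank_blk_def by (rule rank_le_card_nonzero_rows) (simp add: vec_eq_iff)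
  also have "\<dots> \<le> i" using card_idx6_ge[of "6 - i"] by simp
  finally show ?thesis .
qed

lemma rank_blk_le_columns: "rank_blk i j x \<le> j"
proof -
  have "rank_blk i j x \<le> card {c::6. 6 - j \<le> idx6 c}"
    unfolding rank_blk_def by (rule rank_le_card_nonzero_columns) simp
  also have "\<dots> \<le> j" using card_idx6_ge[of "6 - j"] by simp
  finally show ?thesis .
qed

lemma mult_x_left_nth:
  fixes z :: "'a::field^6^6"
  shows "(z ** x_left) $ r $ 0 = 0" "(z ** x_left) $ r $ 1 = 0"
    "(z ** x_left) $ r $ 2 = z $ r $ 0" "(z ** x_left) $ r $ 3 = z $ r $ 1"
    "(z ** x_left) $ r $ 4 = z $ r $ 2" "(z ** x_left) $ r $ 5 = z $ r $ 3"
  by (simp_all add: matrix_matrix_mult_def x_left_def sum_6)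

lemma x_right_mult_nth:
  fixes z :: "'a::field^6^6"
  shows "(x_right ** z) $ 0 $ c = 0" "(x_right ** z) $ 1 $ c = 0"
    "(x_right ** z) $ 2 $ c = z $ 0 $ c" "(x_right ** z) $ 3 $ c = z $ 1 $ c"
    "(x_right ** z) $ 4 $ c = z $ 2 $ c" "(x_right ** z) $ 5 $ c = z $ 3 $ c"
  by (simp_all add: matrix_matrix_mult_def x_right_def x_left_def transpose_def sum_6)

lemma mem_G_R:
  "x \<in> G_R (a, b, c, d) \<longleftrightarrow> invertible x \<and> int (rank_blk 4 4 x) = a \<and> int (rank_blk 4 2 x) = b
     \<and> int (rank_blk 2 4 x) = c \<and> int (rank_blk 2 2 x) = d"
  by (simp add: G_R_def rank_matrix_def)

lemma rank_blk_eq_0_iff: "rank_blk i j x = 0 \<longleftrightarrow> lr_block i j x = 0"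
  unfolding rank_blk_def by (rule rank_eq_0_gen)

section \<open>Minors along differentiable curves\<close>

lemma norm_transpose: "norm (transpose A) = norm (A :: 'a::real_normed_vector^'n^'m)"
proof -
  have "norm (transpose A) ^ 2 = norm A ^ 2"
    by (simp add: norm_vec_def L2_set_def sum_nonneg transpose_def) (rule sum.swap)
  then show ?thesis by simp
qed

lemma bounded_linear_transpose: "bounded_linear (transpose :: 'a::real_normed_vector^'n^'m \<Rightarrow> _)"
proof (rule bounded_linear_intro[where K=1])
  show "norm (transpose A) \<le> norm A * 1" for A :: "'a^'n^'m" by (simp add: norm_transpose)
qed (simp_all add: transpose_def vec_eq_iff)

lemma has_vector_derivative_transpose:
  "(\<gamma> has_vector_derivative v) F \<Longrightarrow> ((\<lambda>t. transpose (\<gamma> t)) has_vector_derivative transpose v) F"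
  by (rule bounded_linear.has_vector_derivative[OF bounded_linear_transpose])

lemma has_vector_derivative_entry:
  "(\<gamma> has_vector_derivative v) F \<Longrightarrow> ((\<lambda>t. \<gamma> t $ i $ j) has_vector_derivative v $ i $ j) F"
  by (rule bounded_linear.has_vector_derivative[OF bounded_linear_compose[OF bounded_linear_vec_nth bounded_linear_vec_nth]])

lemma has_vector_derivative_vanishing:
  assumes "\<And>t. f t = 0" "(f has_vector_derivative D) (at x)" shows "D = 0"
proof -
  have "f = (\<lambda>t. 0)" using assms(1) by auto
  with assms(2) show ?thesis using vector_derivative_unique_at has_vector_derivative_const by metis
qed

lemma entry_derivative_vanishing:
  assumes "(\<gamma> has_vector_derivative v) (at 0)" "\<And>t. \<gamma> t $ r $ c = 0"
  shows "v $ r $ c = 0"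
  using has_vector_derivative_vanishing[OF assms(2) has_vector_derivative_entry[OF assms(1)]] .

lemma minor2_derivative_vanishing:
  fixes \<gamma> :: "real \<Rightarrow> 'a::real_normed_field^'n^'m"
  assumes "(\<gamma> has_vector_derivative v) (at 0)" "\<And>t. minor2 (\<gamma> t) p p' q q' = 0"
  shows "\<gamma> 0$p$q * v$p'$q' + v$p$q * \<gamma> 0$p'$q' - (\<gamma> 0$p$q' * v$p'$q + v$p$q' * \<gamma> 0$p'$q) = 0"
proof (rule has_vector_derivative_vanishing[OF assms(2)])
  show "((\<lambda>t. minor2 (\<gamma> t) p p' q q') has_vector_derivative
     (\<gamma> 0$p$q * v$p'$q' + v$p$q * \<gamma> 0$p'$q' - (\<gamma> 0$p$q' * v$p'$q + v$p$q' * \<gamma> 0$p'$q))) (at 0)"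
    unfolding minor2_def
    by (intro has_vector_derivative_diff has_vector_derivative_mult has_vector_derivative_entry[OF assms(1)])
qed

lemma has_vector_derivative_det3:
  fixes f1 f2 f3 f4 f5 f6 f7 f8 f9 :: "real \<Rightarrow> 'a::real_normed_field"
  assumes "(f1 has_vector_derivative g1) (at x)" "(f2 has_vector_derivative g2) (at x)"
    "(f3 has_vector_derivative g3) (at x)" "(f4 has_vector_derivative g4) (at x)"
    "(f5 has_vector_derivative g5) (at x)" "(f6 has_vector_derivative g6) (at x)"
    "(f7 has_vector_derivative g7) (at x)" "(f8 has_vector_derivative g8) (at x)"
    "(f9 has_vector_derivative g9) (at x)"
  shows "((\<lambda>t. det3 (f1 t) (f2 t) (f3 t) (f4 t) (f5 t) (f6 t) (f7 t) (f8 t) (f9 t)) has_vector_derivative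
      det3 g1 g2 g3 (f4 x) (f5 x) (f6 x) (f7 x) (f8 x) (f9 x)
    + det3 (f1 x) (f2 x) (f3 x) g4 g5 g6 (f7 x) (f8 x) (f9 x)
    + det3 (f1 x) (f2 x) (f3 x) (f4 x) (f5 x) (f6 x) g7 g8 g9) (at x)"
  unfolding det3_def
  by (rule has_vector_derivative_eq_rhs,
      (rule has_vector_derivative_add has_vector_derivative_diff has_vector_derivative_mult assms)+)
     (simp add: algebra_simps)

lemma minor3_derivative_vanishing:
  fixes \<gamma> :: "real \<Rightarrow> 'a::real_normed_field^'n^'m"
  assumes "(\<gamma> has_vector_derivative v) (at 0)" "\<And>t. minor3 (\<gamma> t) p1 p2 p3 q1 q2 q3 = 0"
  shows "det3 (v$p1$q1) (v$p1$q2) (v$p1$q3) (\<gamma> 0$p2$q1) (\<gamma> 0$p2$q2) (\<gamma> 0$p2$q3) (\<gamma> 0$p3$q1) (\<gamma> 0$p3$q2) (\<gamma> 0$p3$q3)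
    + det3 (\<gamma> 0$p1$q1) (\<gamma> 0$p1$q2) (\<gamma> 0$p1$q3) (v$p2$q1) (v$p2$q2) (v$p2$q3) (\<gamma> 0$p3$q1) (\<gamma> 0$p3$q2) (\<gamma> 0$p3$q3)
    + det3 (\<gamma> 0$p1$q1) (\<gamma> 0$p1$q2) (\<gamma> 0$p1$q3) (\<gamma> 0$p2$q1) (\<gamma> 0$p2$q2) (\<gamma> 0$p2$q3) (v$p3$q1) (v$p3$q2) (v$p3$q3) = 0"
proof -
  note e = has_vector_derivative_entry[OF assms(1)]
  show ?thesis
    by (rule has_vector_derivative_vanishing[OF assms(2)[unfolded minor3_def]
        has_vector_derivative_det3[OF e[of p1 q1] e[of p1 q2] e[of p1 q3] e[of p2 q1] e[of p2 q2]
          e[of p2 q3] e[of p3 q1] e[of p3 q2] e[of p3 q3]]])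
qed

section \<open>Curves in \<open>G_R\<close> with velocity \<open>X_right\<close> or \<open>X_left\<close>\<close>

lemma no_X_right_velocity_block42_zero:
  fixes \<gamma> :: "real \<Rightarrow> 'a::real_normed_field^6^6"
  assumes inv: "invertible (\<gamma> 0)" and der: "(\<gamma> has_vector_derivative X_right (\<gamma> 0)) (at 0)"
    and blk: "\<And>t. lr_block 4 2 (\<gamma> t) = 0"
  shows False
proof -
  have vanish: "\<gamma> t $ r $ 4 = 0" if "2 \<le> idx6 r" for t r
    using lr_block_eq_0_entry[OF blk] that by simp
  have shifted: "X_right (\<gamma> 0) $ r $ 4 = 0" if "2 \<le> idx6 r" for r
    using entry_derivative_vanishing[OF der vanish[OF that]] .
  have "\<gamma> 0 $ r $ 4 = 0" for r
    using exhaust_6[of r] vanish[of r 0] shifted[of 2] shifted[of 3]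
    by (auto simp: X_right_def x_right_mult_nth)
  with inv show False using not_invertible_if_column_zero by blast
qed

lemma no_X_right_velocity_block22_zero:
  fixes \<gamma> :: "real \<Rightarrow> 'a::real_normed_field^6^6"
  assumes der: "(\<gamma> has_vector_derivative X_right (\<gamma> 0)) (at 0)"
    and blk: "\<And>t. lr_block 2 2 (\<gamma> t) = 0" and nz: "lr_block 4 2 (\<gamma> 0) \<noteq> 0"
  shows False
proof -
  have vanish: "\<gamma> t $ r $ c = 0" if "4 \<le> idx6 r" "4 \<le> idx6 c" for t r c
    using lr_block_eq_0_entry[OF blk] that by simp
  have shifted: "X_right (\<gamma> 0) $ r $ c = 0" if "4 \<le> idx6 r" "4 \<le> idx6 c" for r c
    using entry_derivative_vanishing[OF der vanish[OF that]] .
  have "\<gamma> 0 $ r $ c = 0" if "2 \<le> idx6 r" "4 \<le> idx6 c" for r c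
    using that exhaust_6[of r] vanish[of r c 0] shifted[of 4 c] shifted[of 5 c]
    by (auto simp: X_right_def x_right_mult_nth)
  with nz show False by (auto elim: lr_block_neq_0_entry)
qed

lemma no_X_right_velocity_block42_rank_le_1:
  fixes \<gamma> :: "real \<Rightarrow> 'a::real_normed_field^6^6"
  assumes inv: "invertible (\<gamma> 0)" and der: "(\<gamma> has_vector_derivative X_right (\<gamma> 0)) (at 0)"
    and rk: "\<And>t. rank_blk 4 2 (\<gamma> t) \<le> 1" and nz: "lr_block 2 2 (\<gamma> 0) \<noteq> 0"
  shows False
proof -
  let ?z = "\<gamma> 0" and ?v = "X_right (\<gamma> 0)"
  obtain s q where s: "4 \<le> idx6 s" and q: "4 \<le> idx6 q" and zsq: "?z $ s $ q \<noteq> 0"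
    using nz by (auto elim: lr_block_neq_0_entry)
  have vanish: "minor2 (\<gamma> t) r r' 4 5 = 0" if "2 \<le> idx6 r" "2 \<le> idx6 r'" for t r r'
    by (rule minor2_lr_block_vanish[OF rk]) (use that in auto)
  have "minor2 ?z r s 4 5 = 0" for r
  proof -
    consider "2 \<le> idx6 r" | "r = 0 \<or> r = 1" using exhaust_6[of r] by fastforce
    then show ?thesis
    proof cases
      case 1
      then show ?thesis using vanish s by simp
    next
      \<comment> \<open>the velocity carries rows \<open>r\<close> and \<open>s - 2\<close> of \<open>z\<close> to rows \<open>r + 2\<close> and \<open>s\<close>\<close>
      case 2
      have "?z$(r+2)$4 * ?v$s$5 + ?v$(r+2)$4 * ?z$s$5 - (?z$(r+2)$5 * ?v$s$4 + ?v$(r+2)$5 * ?z$s$4) = 0"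
        by (rule minor2_derivative_vanishing[OF der vanish]) (use s 2 in auto)
      moreover have "minor2 ?z (r+2) 2 4 5 = 0" "minor2 ?z (r+2) 3 4 5 = 0"
        using vanish 2 by auto
      ultimately show ?thesis using 2 s exhaust_6[of s]
        by (auto simp: X_right_def x_right_mult_nth minor2_def algebra_simps)
    qed
  qed
  moreover have "?z $ s $ 4 \<noteq> 0 \<or> ?z $ s $ 5 \<noteq> 0" using q zsq exhaust_6[of q] by auto
  ultimately show False using not_invertible_if_minors2_vanish[of 4 5 ?z s] inv by auto
qed

lemma no_X_left_velocity_block44_rank_le_2:
  fixes \<gamma> :: "real \<Rightarrow> 'a::real_normed_field^6^6"
  assumes inv: "invertible (\<gamma> 0)" and der: "(\<gamma> has_vector_derivative X_left (\<gamma> 0)) (at 0)"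
    and rk: "\<And>t. rank_blk 4 4 (\<gamma> t) \<le> 2" and nz: "2 \<le> rank_blk 4 2 (\<gamma> 0)"
  shows False
proof -
  let ?z = "\<gamma> 0" and ?v = "X_left (\<gamma> 0)"
  obtain p p' q q' where p: "2 \<le> idx6 p" "2 \<le> idx6 p'" and q: "4 \<le> idx6 q" "4 \<le> idx6 q'"
    and pq: "minor2 ?z p p' q q' \<noteq> 0"
    using nz by (auto elim: minor2_lr_block_nonzero)
  have \<delta>: "minor2 ?z p p' 4 5 \<noteq> 0"
    using q pq exhaust_6[of q] exhaust_6[of q'] by (auto simp: minor2_def algebra_simps)
  obtain a where a: "2 \<le> idx6 a" "a \<noteq> p" "a \<noteq> p'"
    using that[of 2] that[of 3] that[of 4] by fastforce
  have vanish: "minor3 (\<gamma> t) a p p' c c' c'' = 0"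
    if "2 \<le> idx6 c" "2 \<le> idx6 c'" "2 \<le> idx6 c''" for t c c' c''
    by (rule minor3_lr_block_vanish[OF rk]) (use that a p in auto)
  have "minor3 ?z a p p' c 4 5 = 0" for c
  proof -
    consider "2 \<le> idx6 c" | "c = 0 \<or> c = 1" using exhaust_6[of c] by fastforce
    then show ?thesis
    proof cases
      case 1
      then show ?thesis using vanish by simp
    next
      \<comment> \<open>the velocity carries columns \<open>c\<close>, 2, 3 of \<open>z\<close> to columns \<open>c + 2\<close>, 4, 5\<close>
      case 2
      have "det3 (?v$a$(c+2)) (?v$a$4) (?v$a$5) (?z$p$(c+2)) (?z$p$4) (?z$p$5) (?z$p'$(c+2)) (?z$p'$4) (?z$p'$5)
        + det3 (?z$a$(c+2)) (?z$a$4) (?z$a$5) (?v$p$(c+2)) (?v$p$4) (?v$p$5) (?z$p'$(c+2)) (?z$p'$4) (?z$p'$5)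
        + det3 (?z$a$(c+2)) (?z$a$4) (?z$a$5) (?z$p$(c+2)) (?z$p$4) (?z$p$5) (?v$p'$(c+2)) (?v$p'$4) (?v$p'$5)
        = 0"
        by (rule minor3_derivative_vanishing[OF der vanish]) (use 2 in auto)
      moreover have "minor3 ?z a p p' (c+2) 2 5 = 0" "minor3 ?z a p p' (c+2) 4 3 = 0"
        using vanish 2 by auto
      ultimately show ?thesis using 2
        by (auto simp: X_left_def mult_x_left_nth minor3_def det3_def algebra_simps)
    qed
  qed
  with inv \<delta> a show False using not_invertible_if_minors3_vanish by blast
qed

lemma no_X_right_velocity:
  fixes \<gamma> :: "real \<Rightarrow> 'a::real_normed_field^6^6"
  assumes "invertible (\<gamma> 0)" "(\<gamma> has_vector_derivative X_right (\<gamma> 0)) (at 0)"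
    and "(\<forall>t. lr_block 4 2 (\<gamma> t) = 0)
      \<or> (\<forall>t. lr_block 2 2 (\<gamma> t) = 0) \<and> lr_block 4 2 (\<gamma> 0) \<noteq> 0
      \<or> (\<forall>t. rank_blk 4 2 (\<gamma> t) \<le> 1) \<and> lr_block 2 2 (\<gamma> 0) \<noteq> 0"
  shows False
  using assms no_X_right_velocity_block42_zero no_X_right_velocity_block22_zero
    no_X_right_velocity_block42_rank_le_1 by blast

lemma no_X_left_velocity:
  fixes \<gamma> :: "real \<Rightarrow> 'a::real_normed_field^6^6"
  assumes inv: "invertible (\<gamma> 0)" and der: "(\<gamma> has_vector_derivative X_left (\<gamma> 0)) (at 0)"
    and blk: "(\<forall>t. lr_block 2 4 (\<gamma> t) = 0)
      \<or> (\<forall>t. lr_block 2 2 (\<gamma> t) = 0) \<and> lr_block 2 4 (\<gamma> 0) \<noteq> 0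
      \<or> (\<forall>t. rank_blk 2 4 (\<gamma> t) \<le> 1) \<and> lr_block 2 2 (\<gamma> 0) \<noteq> 0"
  shows False
proof (rule no_X_right_velocity)
  let ?\<delta> = "\<lambda>t. transpose (\<gamma> t)"
  show "invertible (?\<delta> 0)" using inv by (rule invertible_transpose_gen)
  show "(?\<delta> has_vector_derivative X_right (?\<delta> 0)) (at 0)"
    using has_vector_derivative_transpose[OF der]
    by (simp add: X_left_def X_right_def x_right_def matrix_transpose_mul)
  have rank: "rank_blk 4 2 (?\<delta> t) \<le> 1" if "rank_blk 2 4 (\<gamma> t) \<le> 1" for t
    using rank_transpose_le_1 that by (simp add: rank_blk_def lr_block_transpose)
  then show "(\<forall>t. lr_block 4 2 (?\<delta> t) = 0)
      \<or> (\<forall>t. lr_block 2 2 (?\<delta> t) = 0) \<and> lr_block 4 2 (?\<delta> 0) \<noteq> 0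
      \<or> (\<forall>t. rank_blk 4 2 (?\<delta> t) \<le> 1) \<and> lr_block 2 2 (?\<delta> 0) \<noteq> 0"
    using blk rank by (auto simp: lr_block_transpose transpose_eq_0_iff)
qed

lemma transversal_X_right_G_R:
  assumes "b = 0 \<or> b = 1 \<or> d = 0"
  shows "transversal X_right (G_R (a, b, c, d) :: ('a::real_normed_field^6^6) set)"
  unfolding transversal_def tangent_space_def
proof clarify
  fix \<gamma> :: "real \<Rightarrow> 'a^6^6"
  assume mem: "\<forall>t. \<gamma> t \<in> G_R (a, b, c, d)" and der: "(\<gamma> has_vector_derivative X_right (\<gamma> 0)) (at 0)"
  then have "rank_blk 4 2 (\<gamma> t) = nat b" "rank_blk 2 2 (\<gamma> t) = nat d" "0 \<le> b" "0 \<le> d" for t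
    by (auto simp: mem_G_R)
  with assms have "(\<forall>t. lr_block 4 2 (\<gamma> t) = 0)
      \<or> (\<forall>t. lr_block 2 2 (\<gamma> t) = 0) \<and> lr_block 4 2 (\<gamma> 0) \<noteq> 0
      \<or> (\<forall>t. rank_blk 4 2 (\<gamma> t) \<le> 1) \<and> lr_block 2 2 (\<gamma> 0) \<noteq> 0"
    by (simp flip: rank_blk_eq_0_iff) linarith
  moreover have "invertible (\<gamma> 0)" using mem by (simp add: mem_G_R)
  ultimately show False using der no_X_right_velocity by blast
qed

lemma transversal_X_left_G_R:
  assumes "c = 0 \<or> c = 1 \<or> d = 0"
  shows "transversal X_left (G_R (a, b, c, d) :: ('a::real_normed_field^6^6) set)"
  unfolding transversal_def tangent_space_def
proof clarify
  fix \<gamma> :: "real \<Rightarrow> 'a^6^6"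
  assume mem: "\<forall>t. \<gamma> t \<in> G_R (a, b, c, d)" and der: "(\<gamma> has_vector_derivative X_left (\<gamma> 0)) (at 0)"
  then have "rank_blk 2 4 (\<gamma> t) = nat c" "rank_blk 2 2 (\<gamma> t) = nat d" "0 \<le> c" "0 \<le> d" for t
    by (auto simp: mem_G_R)
  with assms have "(\<forall>t. lr_block 2 4 (\<gamma> t) = 0)
      \<or> (\<forall>t. lr_block 2 2 (\<gamma> t) = 0) \<and> lr_block 2 4 (\<gamma> 0) \<noteq> 0
      \<or> (\<forall>t. rank_blk 2 4 (\<gamma> t) \<le> 1) \<and> lr_block 2 2 (\<gamma> 0) \<noteq> 0"
    by (simp flip: rank_blk_eq_0_iff) linarith
  moreover have "invertible (\<gamma> 0)" using mem by (simp add: mem_G_R)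
  ultimately show False using der no_X_left_velocity by blast
qed

lemma transversal_X_left_G_R_block44_rank_le_2:
  assumes "a \<le> 2" "2 \<le> b"
  shows "transversal X_left (G_R (a, b, c, d) :: ('a::real_normed_field^6^6) set)"
  unfolding transversal_def tangent_space_def
proof clarify
  fix \<gamma> :: "real \<Rightarrow> 'a^6^6"
  assume mem: "\<forall>t. \<gamma> t \<in> G_R (a, b, c, d)" and der: "(\<gamma> has_vector_derivative X_left (\<gamma> 0)) (at 0)"
  then have "invertible (\<gamma> 0)" "rank_blk 4 4 (\<gamma> t) \<le> 2" "2 \<le> rank_blk 4 2 (\<gamma> 0)" for t
    using assms by (auto simp: mem_G_R)
  with der show False by (blast intro: no_X_left_velocity_block44_rank_le_2)
qed

lemma transversal_X_left_or_X_right: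
  assumes "G_R R \<noteq> ({} :: ('a::real_normed_field^6^6) set)" and "R \<notin> exceptional_R"
  shows "transversal X_left (G_R R :: ('a^6^6) set) \<or> transversal X_right (G_R R :: ('a^6^6) set)"
proof -
  obtain a b c d where R: "R = (a, b, c, d)" by (cases R)
  obtain x :: "'a^6^6" where "x \<in> G_R R" using assms(1) by blast
  then have bounds: "0 \<le> a \<and> a \<le> 4" "0 \<le> b \<and> b \<le> 2" "0 \<le> c \<and> c \<le> 2" "0 \<le> d \<and> d \<le> 2"
    using rank_blk_le_rows[of 4 _ x] rank_blk_le_columns[of _ 2 x] rank_blk_le_rows[of 2 _ x]
    by (auto simp: R mem_G_R)
  consider "b = 0 \<or> b = 1 \<or> d = 0" | "c = 0 \<or> c = 1" | "a \<le> 2" "2 \<le> b"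
  proof (rule ccontr)
    assume "\<not> thesis"
    with that have "\<not> (b = 0 \<or> b = 1 \<or> d = 0)" "\<not> (c = 0 \<or> c = 1)" "\<not> (a \<le> 2 \<and> 2 \<le> b)"
      by blast+
    with bounds have "b = 2" "c = 2" "d = 1 \<or> d = 2" "a = 3 \<or> a = 4" by auto
    with assms(2) show False by (auto simp: R exceptional_R_def)
  qed
  then show ?thesis
  proof cases
    case 1
    then show ?thesis unfolding R using transversal_X_right_G_R by blast
  next
    case 2
    then show ?thesis unfolding R using transversal_X_left_G_R by blast
  next
    case 3
    then show ?thesis unfolding R using transversal_X_left_G_R_block44_rank_le_2 by blast
  qed
qed

theorem proposition4p2:
  fixes R :: "int \<times> int \<times> int \<times> int"
  assumes "R \<notin> exceptional_R"
  shows "(G_R R \<noteq> ({} :: (real^6^6) set) \<longrightarrow>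
            transversal X_left (G_R R :: (real^6^6) set) \<or> transversal X_right (G_R R :: (real^6^6) set))
       \<and> (G_R R \<noteq> ({} :: (complex^6^6) set) \<longrightarrow>
            transversal X_left (G_R R :: (complex^6^6) set) \<or> transversal X_right (G_R R :: (complex^6^6) set))"
  using transversal_X_left_or_X_right[where 'a=real, OF _ assms]
    transversal_X_left_or_X_right[where 'a=complex, OF _ assms] by blast

end
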